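(* The equation $h(x)=1$ has a unique solution $\lambda_\infty\in\bigl(\tfrac14,+\infty\bigr)$, where $h(x)=\sum_{p\text{ prime}}\frac{1}{xp^2-p+1}$.
   Context: The sum defining $h$ ranges over all prime numbers $p=2,3,5,7,\ldots$; $h$ is considered as a function on $\bigl(\tfrac14,+\infty\bigr)$. *)

theory Defs
  imports "HOL-Analysis.Infinite_Sum" "HOL-Computational_Algebra.Primes"
begin

(* Only meant for x > 1/4, where every denominator is positive and the series converges.
   A divergent infsum is 0 by convention, so h x = 1 always entails genuine convergence. *)
definition h :: "real \<Rightarrow> real" where
  "h x = (\<Sum>\<^sub>\<infinity>p\<in>{p::nat. prime p}. 1 / (x * (real p)^2 - real p + 1))"

end

theory Submission
  imports Defs "HOL-Analysis.Lipschitz"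
begin

text \<open>
  For \<open>x > 1/4\<close> the identity \<open>x p\<^sup>2 - p + 1 = (x - 1/4) p\<^sup>2 + (p/2 - 1)\<^sup>2\<close> bounds every
  denominator below by \<open>(x - 1/4) p\<^sup>2\<close>.  So the series is dominated by a multiple of
  \<open>\<Sum> 1/p\<^sup>2\<close>, and everything follows from this bound: the denominators are positive and
  increase with \<open>x\<close>, so \<open>h\<close> is strictly decreasing (\<open>h_strict_antimono\<close>), which gives uniqueness;
  \<open>h\<close> is at most \<open>C / (x - 1/4)\<close> with \<open>C = \<Sum> 1/p\<^sup>2\<close> (\<open>h_upper_bound\<close>), hence drops below \<open>1\<close>;
  and for \<open>x, y \<ge> 1/2\<close> the terms of \<open>h x\<close> and \<open>h y\<close> at \<open>p\<close> differ by at most a constant times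
  \<open>\<bar>x - y\<bar> / p\<^sup>2\<close>, so \<open>h\<close> is continuous on \<open>[1/2, \<infinity>)\<close> (\<open>h_lipschitz\<close>).  Since the term at
  \<open>p = 2\<close> equals \<open>1\<close> for \<open>x = 1/2\<close> and all others are positive, \<open>h (1/2) > 1\<close>, and the
  intermediate value theorem gives existence.
\<close>

definition h_denom :: "real \<Rightarrow> nat \<Rightarrow> real" where
  "h_denom x p = x * (real p)^2 - real p + 1"

lemma h_eq_infsum_denom: "h x = (\<Sum>\<^sub>\<infinity>p\<in>{p. prime p}. 1 / h_denom x p)"
  by (simp add: h_def h_denom_def)

definition prime_zeta_two :: real where
  "prime_zeta_two = (\<Sum>\<^sub>\<infinity>p\<in>{p::nat. prime p}. 1 / (real p)^2)"

lemma inverse_prime_squares_summable: "(\<lambda>p. 1 / (real p)^2) summable_on {p. prime p}"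
proof -
  have "summable (\<lambda>n. 1 / (real n)^2)"
    using inverse_power_summable[of 2, where 'a=real] by (simp add: field_simps)
  then have "(\<lambda>n. 1 / (real n)^2) summable_on UNIV"
    by (intro norm_summable_imp_summable_on) simp
  then show ?thesis
    by (rule summable_on_subset_banach) simp
qed

lemma prime_zeta_two_nonneg: "0 \<le> prime_zeta_two"
  unfolding prime_zeta_two_def by (intro infsum_nonneg) simp

text \<open>
  The complete-square decomposition behind all estimates; equality holds at \<open>p = 2\<close>, which is
  why \<open>1/4\<close> is the natural left end point.
\<close>

lemma h_denom_ge: "(x - 1/4) * (real p)^2 \<le> h_denom x p"
proof -
  have "h_denom x p = (x - 1/4) * (real p)^2 + (real p / 2 - 1)^2"
    by (simp add: h_denom_def power2_eq_square field_simps)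
  then show ?thesis by simp
qed

lemma h_denom_pos:
  assumes "1/4 < x" "prime p"
  shows "0 < h_denom x p"
proof -
  have "0 < (x - 1/4) * (real p)^2"
    using assms prime_gt_0_nat[of p] by simp
  then show ?thesis using h_denom_ge[of x p] by linarith
qed

lemma h_term_le:
  assumes "1/4 < x" "prime p"
  shows "1 / h_denom x p \<le> 1 / (x - 1/4) * (1 / (real p)^2)"
proof -
  have "0 < (x - 1/4) * (real p)^2"
    using assms prime_gt_0_nat[of p] by simp
  then have "1 / h_denom x p \<le> 1 / ((x - 1/4) * (real p)^2)"
    using h_denom_ge[of x p] by (intro frac_le) simp_all
  then show ?thesis by simp
qed

lemma h_terms_summable:
  assumes "1/4 < x"
  shows "(\<lambda>p. 1 / h_denom x p) summable_on {p. prime p}"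
proof (rule summable_on_comparison_test)
  show "(\<lambda>p. 1 / (x - 1/4) * (1 / (real p)^2)) summable_on {p. prime p}"
    by (intro summable_on_cmult_right inverse_prime_squares_summable)
qed (use assms h_term_le h_denom_pos in \<open>auto intro: less_imp_le\<close>)

lemma h_upper_bound:
  assumes "1/4 < x"
  shows "h x \<le> prime_zeta_two / (x - 1/4)"
proof -
  have "h x \<le> (\<Sum>\<^sub>\<infinity>p\<in>{p. prime p}. 1 / (x - 1/4) * (1 / (real p)^2))"
    unfolding h_eq_infsum_denom
    using assms h_term_le
    by (intro infsum_mono h_terms_summable summable_on_cmult_right
        inverse_prime_squares_summable) auto
  also have "\<dots> = prime_zeta_two / (x - 1/4)"
    unfolding prime_zeta_two_def by (subst infsum_cmult_right') simp
  finally show ?thesis .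
qed

lemma h_diff_has_sum:
  assumes "1/4 < x" "1/4 < y"
  shows "((\<lambda>p. 1 / h_denom x p - 1 / h_denom y p) has_sum (h x - h y)) {p. prime p}"
proof -
  have sums: "((\<lambda>p. 1 / h_denom z p) has_sum h z) {p. prime p}" if "1/4 < z" for z
    unfolding h_eq_infsum_denom using that by (intro has_sum_infsum h_terms_summable)
  show ?thesis
    using has_sum_add[OF sums[OF assms(1)] has_sum_uminusI[OF sums[OF assms(2)]]] by simp
qed

lemma h_term_strict_antimono:
  assumes "1/4 < x" "x < y" "prime p"
  shows "1 / h_denom y p < 1 / h_denom x p"
proof -
  have "h_denom x p < h_denom y p"
    using assms prime_gt_0_nat[of p] by (simp add: h_denom_def)
  then show ?thesis
    using h_denom_pos[of x p] assms by (simp add: frac_less2)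
qed

text \<open>
  Termwise strictness survives summation because the difference of the two sums is at least its
  single term at \<open>p = 2\<close>.
\<close>

lemma h_strict_antimono:
  assumes "1/4 < x" "x < y"
  shows "h y < h x"
proof -
  let ?d = "\<lambda>p. 1 / h_denom x p - 1 / h_denom y p"
  have "sum ?d {2} \<le> h x - h y"
  proof (rule finite_sum_le_has_sum)
    show "(?d has_sum (h x - h y)) {p. prime p}"
      using assms by (intro h_diff_has_sum) auto
    show "0 \<le> ?d p" if "p \<in> {p. prime p} - {2}" for p
      using h_term_strict_antimono[OF assms, of p] that by simp
  qed auto
  moreover have "0 < ?d 2"
    using h_term_strict_antimono[OF assms two_is_prime_nat] by simp
  ultimately show ?thesis by simp
qed

text \<open>
  The difference of two terms is \<open>(y - x) p\<^sup>2\<close> divided by the product of two denominators.  At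
  distance at least \<open>1/4\<close> from the singularity of \<open>h\<close> at \<open>1/4\<close>, each of them is at least
  \<open>p\<^sup>2 / 4\<close>, which produces the constant \<open>16\<close>.
\<close>

lemma h_term_diff_le:
  assumes "1/2 \<le> x" "x \<le> y" "prime p"
  shows "1 / h_denom x p - 1 / h_denom y p \<le> 16 * (y - x) * (1 / (real p)^2)"
proof -
  have p: "0 < (real p)^2" using prime_gt_0_nat[OF assms(3)] by simp
  have lower: "(real p)^2 / 4 \<le> h_denom z p" if "1/2 \<le> z" for z
  proof -
    have "1/4 * (real p)^2 \<le> (z - 1/4) * (real p)^2"
      using that by (intro mult_right_mono) auto
    then show ?thesis using h_denom_ge[of z p] by simp
  qed
  have pos: "0 < h_denom x p" "0 < h_denom y p"
    using assms h_denom_pos[of x p] h_denom_pos[of y p] by auto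
  have "1 / h_denom x p - 1 / h_denom y p = (y - x) * (real p)^2 / (h_denom x p * h_denom y p)"
  proof -
    have "1 / h_denom x p - 1 / h_denom y p
        = (h_denom y p - h_denom x p) / (h_denom x p * h_denom y p)"
      using pos by (simp add: field_simps)
    also have "h_denom y p - h_denom x p = (y - x) * (real p)^2"
      by (simp add: h_denom_def algebra_simps)
    finally show ?thesis .
  qed
  also have "\<dots> \<le> (y - x) * (real p)^2 / ((real p)^2 / 4 * ((real p)^2 / 4))"
    using assms p lower[of x] lower[of y] pos
    by (intro divide_left_mono mult_mono mult_pos_pos) auto
  also have "\<dots> = 16 * (y - x) * (1 / (real p)^2)"
    using p by (simp add: field_simps)
  finally show ?thesis .
qed

lemma h_lipschitz:
  assumes "1/2 \<le> x" "x \<le> y"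
  shows "h x - h y \<le> 16 * prime_zeta_two * (y - x)"
proof -
  have "((\<lambda>p. 1 / (real p)^2) has_sum prime_zeta_two) {p. prime p}"
    unfolding prime_zeta_two_def by (intro has_sum_infsum inverse_prime_squares_summable)
  then have "((\<lambda>p. 16 * (y - x) * (1 / (real p)^2)) has_sum (16 * (y - x) * prime_zeta_two))
      {p. prime p}"
    by (rule has_sum_cmult_right)
  with h_diff_has_sum[of x y] have "h x - h y \<le> 16 * (y - x) * prime_zeta_two"
    by (rule has_sum_mono) (use assms h_term_diff_le[OF assms] in auto)
  then show ?thesis by (simp add: mult_ac)
qed

lemma h_continuous_on: "continuous_on {1/2..} h"
proof -
  have "\<bar>h x - h y\<bar> \<le> 16 * prime_zeta_two * \<bar>x - y\<bar>" if "1/2 \<le> x" "1/2 \<le> y" for x y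
    using that h_lipschitz[of x y] h_lipschitz[of y x]
      h_strict_antimono[of x y] h_strict_antimono[of y x]
    by (cases x y rule: linorder_cases) auto
  then have "(16 * prime_zeta_two)-lipschitz_on {1/2..} h"
    by (intro lipschitz_onI) (auto simp: dist_real_def prime_zeta_two_nonneg)
  then show ?thesis by (rule lipschitz_on_continuous_on)
qed

text \<open>
  The point \<open>1/2\<close> is where the term at \<open>p = 2\<close> equals exactly \<open>1\<close>; the term at \<open>p = 3\<close> then
  makes the inequality strict.
\<close>

lemma h_half_gt_one: "1 < h (1/2)"
proof -
  have "(\<Sum>p\<in>{2,3}. 1 / h_denom (1/2) p) \<le> h (1/2)"
    unfolding h_eq_infsum_denom
    using h_denom_pos[of "1/2"]
    by (intro finite_sum_le_infsum h_terms_summable) (auto intro: less_imp_le)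
  then show ?thesis by (simp add: h_denom_def)
qed

theorem theorem3p1: "\<exists>!l::real. l \<in> {1/4<..} \<and> h l = 1"
proof (rule ex_ex1I)
  \<comment> \<open>The upper bound for \<open>h\<close> at this point is \<open>C / (C + 1)\<close> with \<open>C = \<Sum> 1/p\<^sup>2\<close>.\<close>
  define M where "M = prime_zeta_two + 5/4"
  have M: "1/2 \<le> M"
    using prime_zeta_two_nonneg by (simp add: M_def)
  have "h M \<le> prime_zeta_two / (prime_zeta_two + 1)"
    using h_upper_bound[of M] M by (simp add: M_def add.commute)
  also have "\<dots> \<le> 1"
    using prime_zeta_two_nonneg by simp
  finally have "h M \<le> 1" .
  moreover have "continuous_on {1/2..M} h"
    by (rule continuous_on_subset[OF h_continuous_on]) auto
  ultimately obtain l where "1/2 \<le> l" "h l = 1"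
    using IVT2'[of h M 1 "1/2"] h_half_gt_one M by auto
  then show "\<exists>l. l \<in> {1/4<..} \<and> h l = 1"
    by (intro exI[of _ l]) auto
next
  fix l m :: real
  assume "l \<in> {1/4<..} \<and> h l = 1" "m \<in> {1/4<..} \<and> h m = 1"
  then show "l = m"
    using h_strict_antimono[of l m] h_strict_antimono[of m l]
    by (cases l m rule: linorder_cases) auto
qed

end
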